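(* Let $0<\alpha<1$, $x_\alpha=(2/\alpha)^{1/\alpha}$, and $$U(x)=\begin{cases}\left(\frac{e\alpha}{2}\right)^{2/\alpha}x^2,&|x|\le x_\alpha,\\ \exp\{|x|^\alpha\},&|x|>x_\alpha.\end{cases}$$ Then the Orlicz space $L_U(\Omega)$ satisfies condition $\mathbf H$ with the constant $C_U=4\cdot9^{1/\alpha}\big(C_{\psi U}/C_{U\psi}\big)^2$, i.e. for any centered independent random variables $\xi_1,\dots,\xi_n\in L_U(\Omega)$ $$\Big\|\sum_{k=1}^n\xi_k\Big\|_U^2\le4\cdot9^{1/\alpha}\Big(\frac{C_{\psi U}}{C_{U\psi}}\Big)^2\sum_{k=1}^n\|\xi_k\|_U^2,$$ where $$C_{\psi U}=e^{2/\alpha+2}\Big(1+\frac{e^{1/12}}{\sqrt{2\pi}}\Big)^{1/\alpha}e^{1/\alpha},\qquad C_{U\psi}=\frac1{2^{1/\alpha}}\big(e^{2/\alpha}+1\big)^{-1/\alpha}\alpha^{1/\alpha}e^{1/\alpha}.$$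
   Context: For a $C$-function $U$ (continuous, even, convex, monotonically increasing for $x>0$, $U(0)=0$), the Orlicz space $L_U(\Omega)$ is the family of random variables $\xi$ for which there is $r_\xi>0$ with $EU(\xi/r_\xi)<\infty$, with the Luxemburg norm $\|\xi\|_U=\inf\{r>0:EU(\xi/r)\le1\}$. *)

theory Defs
  imports "HOL-Probability.Probability"
begin

text \<open>``Monotonically increasing'' is read as strictly increasing.\<close>

definition C_function :: "(real \<Rightarrow> real) \<Rightarrow> bool" where
  "C_function U \<longleftrightarrow>
     continuous_on UNIV U \<and> (\<forall>x. U (- x) = U x) \<and> convex_on UNIV U \<and>
     strict_mono_on {0<..} U \<and> U 0 = 0"

text \<open>
  A \<open>C\<close>-function is nonnegative, so \<open>ennreal\<close> truncates nothing, and the expectation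
  \<open>E U(\<xi> / r)\<close> is the Lebesgue integral with values in \<open>[0, \<infinity>]\<close>. Random variables are not
  identified when they agree almost surely.
\<close>

definition orlicz_space :: "'a measure \<Rightarrow> (real \<Rightarrow> real) \<Rightarrow> ('a \<Rightarrow> real) set" where
  "orlicz_space M U =
     {\<xi> \<in> borel_measurable M. \<exists>r>0. (\<integral>\<^sup>+\<omega>. ennreal (U (\<xi> \<omega> / r)) \<partial>M) < \<infinity>}"

text \<open>
  The infimum is that of the reals, meaningful on \<open>orlicz_space M U\<close>, where the set is nonempty.
\<close>

definition luxemburg_norm :: "'a measure \<Rightarrow> (real \<Rightarrow> real) \<Rightarrow> ('a \<Rightarrow> real) \<Rightarrow> real" where
  "luxemburg_norm M U \<xi> =
     Inf {r. r > 0 \<and> (\<integral>\<^sup>+\<omega>. ennreal (U (\<xi> \<omega> / r)) \<partial>M) \<le> 1}"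

text \<open>
  Integrability is part of being centered, since the Bochner integral of a nonintegrable function
  is \<open>0\<close> by convention.
\<close>

definition centered :: "'a measure \<Rightarrow> ('a \<Rightarrow> real) \<Rightarrow> bool" where
  "centered M \<xi> \<longleftrightarrow> integrable M \<xi> \<and> (\<integral>\<omega>. \<xi> \<omega> \<partial>M) = 0"

definition condition_H ::
    "'a measure \<Rightarrow> ('a \<Rightarrow> real) set \<Rightarrow> (('a \<Rightarrow> real) \<Rightarrow> real) \<Rightarrow> real \<Rightarrow> bool" where
  "condition_H M B N C \<longleftrightarrow>
     (\<forall>(n::nat) \<xi>.
        (\<forall>k\<in>{1..n}. \<xi> k \<in> B \<and> centered M (\<xi> k)) \<longrightarrow>
        prob_space.indep_vars M (\<lambda>_. borel) \<xi> {1..n} \<longrightarrow>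
        (N (\<lambda>\<omega>. \<Sum>k=1..n. \<xi> k \<omega>))\<^sup>2 \<le> C * (\<Sum>k=1..n. (N (\<xi> k))\<^sup>2))"

definition x_alpha :: "real \<Rightarrow> real" where
  "x_alpha \<alpha> = (2 / \<alpha>) powr (1 / \<alpha>)"

definition U_alpha :: "real \<Rightarrow> real \<Rightarrow> real" where
  "U_alpha \<alpha> x =
     (if \<bar>x\<bar> \<le> x_alpha \<alpha> then (exp 1 * \<alpha> / 2) powr (2 / \<alpha>) * x\<^sup>2
      else exp (\<bar>x\<bar> powr \<alpha>))"

definition C_psi_U :: "real \<Rightarrow> real" where
  "C_psi_U \<alpha> =
     exp (2 / \<alpha> + 2) * (1 + exp (1 / 12) / sqrt (2 * pi)) powr (1 / \<alpha>) * exp (1 / \<alpha>)"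

definition C_U_psi :: "real \<Rightarrow> real" where
  "C_U_psi \<alpha> =
     1 / 2 powr (1 / \<alpha>) * (exp (2 / \<alpha>) + 1) powr (- 1 / \<alpha>) * \<alpha> powr (1 / \<alpha>) * exp (1 / \<alpha>)"

lemma C_function_U_alpha:
  assumes "0 < \<alpha>" "\<alpha> < 1"
  shows "C_function (U_alpha \<alpha>)"
proof -
  define a where "a = x_alpha \<alpha>"
  define c where "c = (exp 1 * \<alpha> / 2) powr (2 / \<alpha>)"
  define g where "g = (\<lambda>x::real. if x \<in> {..a} then c * x\<^sup>2 else exp (x powr \<alpha>))"
  define h where "h = (\<lambda>x::real. \<alpha> * x powr (\<alpha> - 1) * exp (x powr \<alpha>))"
  define g' where "g' = (\<lambda>x::real. if x \<in> {..a} then 2 * c * x else h x)"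
  have a: "a > 0" and c: "c > 0"
    using assms by (auto simp: a_def x_alpha_def c_def)
  have aa: "a powr \<alpha> = 2 / \<alpha>"
    using assms by (simp add: a_def x_alpha_def powr_powr)
  have a2: "a\<^sup>2 = (2 / \<alpha>) powr (2 / \<alpha>)"
    using assms by (simp add: a_def x_alpha_def powr_powr flip: powr_numeral)
  have ca: "c * a\<^sup>2 = exp (a powr \<alpha>)"
  proof -
    have "c * a\<^sup>2 = (exp 1 * \<alpha> / 2 * (2 / \<alpha>)) powr (2 / \<alpha>)"
      unfolding c_def a2 using assms by (subst powr_mult) auto
    also have "\<dots> = exp (2 / \<alpha>)"
      using assms by (simp add: powr_def)
    finally show ?thesis by (simp add: aa)
  qed
  have ha: "h a = 2 * c * a"
  proof -
    have "h a = \<alpha> * (a powr \<alpha> / a) * (c * a\<^sup>2)"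
      using a by (simp add: h_def ca powr_diff)
    also have "\<dots> = 2 * c * a"
      using a assms by (simp add: aa power2_eq_square field_simps)
    finally show ?thesis .
  qed
  have der_q: "((\<lambda>x. c * x\<^sup>2) has_real_derivative 2 * c * x) F" if "F = at x within S" for x F S
    unfolding that by (auto intro!: derivative_eq_intros)
  have der_e: "((\<lambda>x. exp (x powr \<alpha>)) has_real_derivative h x) (at x within S)"
    if "x > 0" for x S
    using that assms unfolding h_def
    by (auto intro!: derivative_eq_intros)
  have der: "(g has_real_derivative g' x) (at x)" for x
    unfolding has_real_derivative_iff_has_vector_derivative g_def g'_def
    by (rule has_vector_derivative_If_within_closures[where T = "{a<..}"])
      (use a ca ha in \<open>auto simp flip: has_real_derivative_iff_has_vector_derivative
         intro!: der_q der_e\<close>)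
  have h_mono: "h x \<le> h y" if "a \<le> x" "x \<le> y" for x y
  proof (rule DERIV_nonneg_imp_nondecreasing[OF that(2)])
    fix z assume z: "x \<le> z" "z \<le> y"
    have "z > 0" using z that a by simp
    have "a powr \<alpha> \<le> z powr \<alpha>"
      using z that a assms by (intro powr_mono2) auto
    then have "2 \<le> \<alpha> * z powr \<alpha>"
      using assms by (simp add: aa field_simps)
    then have "0 \<le> \<alpha> * z powr (\<alpha> - 2) * exp (z powr \<alpha>) * (\<alpha> - 1 + \<alpha> * z powr \<alpha>)"
      using assms by simp
    moreover have "DERIV h z :> \<alpha> * z powr (\<alpha> - 2) * exp (z powr \<alpha>) * (\<alpha> - 1 + \<alpha> * z powr \<alpha>)"
    proof -
      have "DERIV h z :> \<alpha> * ((\<alpha> - 1) * z powr (\<alpha> - 1 - 1)) * exp (z powr \<alpha>) +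
          \<alpha> * z powr (\<alpha> - 1) * h z"
        using DERIV_mult[OF DERIV_cmult[OF has_real_derivative_powr[OF \<open>z > 0\<close>]] der_e[OF \<open>z > 0\<close>],
            of \<alpha> "\<alpha> - 1"]
        unfolding h_def by (simp add: algebra_simps)
      then show ?thesis
        using \<open>z > 0\<close> by (simp add: h_def powr_diff power2_eq_square field_simps)
    qed
    ultimately show "\<exists>d. DERIV h z :> d \<and> 0 \<le> d" by blast
  qed
  have g'_mono: "g' x \<le> g' y" if "x \<le> y" for x y
  proof -
    have "2 * c * x \<le> h y" if "x \<le> a" "a < y"
    proof -
      have "2 * c * x \<le> 2 * c * a" using that c by simp
      also have "\<dots> \<le> h y" using h_mono[of a y] that by (simp add: ha)
      finally show ?thesis .
    qed
    then show ?thesis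
      using that c h_mono[of x y] by (auto simp: g'_def)
  qed
  have g_conv: "convex_on UNIV g"
    by (rule convex_on_realI[where f' = g']) (auto intro: der g'_mono)
  have g'_pos: "g' x > 0" if "x > 0" for x
    using that c assms by (auto simp: g'_def h_def)
  have g_less: "g x < g y" if "0 < x" "x < y" for x y
    by (rule DERIV_pos_imp_increasing[OF that(2)]) (use that in \<open>force intro: der g'_pos\<close>)
  have g0: "g 0 = 0" using a by (simp add: g_def)
  have g_le: "g x \<le> g y" if "0 \<le> x" "x \<le> y" for x y
  proof (cases "x = 0")
    case True
    then show ?thesis using g0 c by (auto simp: g_def)
  next
    case False
    then show ?thesis using that g_less[of x y] by (cases "x = y") auto
  qed
  have U: "U_alpha \<alpha> x = g \<bar>x\<bar>" for x
    by (simp add: U_alpha_def g_def a_def c_def)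
  have conv: "convex_on UNIV (U_alpha \<alpha>)"
  proof (rule convex_onI)
    fix t x y :: real assume t: "0 < t" "t < 1"
    have "\<bar>(1 - t) * x + t * y\<bar> \<le> \<bar>(1 - t) * x\<bar> + \<bar>t * y\<bar>"
      by (rule abs_triangle_ineq)
    also have "\<dots> = (1 - t) * \<bar>x\<bar> + t * \<bar>y\<bar>"
      using t by (simp add: abs_mult)
    finally have "g \<bar>(1 - t) * x + t * y\<bar> \<le> g ((1 - t) * \<bar>x\<bar> + t * \<bar>y\<bar>)"
      by (intro g_le) auto
    also have "\<dots> \<le> (1 - t) * g \<bar>x\<bar> + t * g \<bar>y\<bar>"
      using convex_onD[OF g_conv, of t "\<bar>x\<bar>" "\<bar>y\<bar>"] t by simp
    finally show "U_alpha \<alpha> ((1 - t) *\<^sub>R x + t *\<^sub>R y) \<le> (1 - t) * U_alpha \<alpha> x + t * U_alpha \<alpha> y"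
      by (simp add: U)
  qed simp
  show ?thesis
    unfolding C_function_def
    using conv g0 convex_on_continuous[OF open_UNIV conv]
    by (auto simp: U intro!: strict_mono_onI g_less)
qed

end

theory Submission
  imports Defs
begin

text \<open>
  Put \<open>p = 1 / \<alpha> > 1\<close>. Variables in \<open>L\<^sub>U\<close> need not have exponential moments, so the classical proof
  for sub-Gaussian variables, which multiplies moment generating functions, cannot be used as it
  is. It can be repeated with the series
  \<open>F\<^bsub>X\<^esub>(t) = \<Sum>n. |E X^n| t^n / (n!)^p\<close>.
  In the binomial expansion of \<open>E (X + Y)^n\<close> for independent \<open>X\<close>, \<open>Y\<close>, dividing by \<open>(n!)^p\<close>
  instead of \<open>n!\<close> leaves the surplus factor \<open>(n choose j)^(1 - p)\<close>, which is at most \<open>1\<close>. Hence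
  \<open>F\<close> is no longer multiplicative but still submultiplicative: \<open>F\<^bsub>X+Y\<^esub> \<le> F\<^bsub>X\<^esub> F\<^bsub>Y\<^esub>\<close>
  (\<open>moment_series_le_add\<close>).

  The growth of \<open>U\<close> matches these weights: \<open>|x|^n \<le> q^n (n!)^p U(x)\<close> for \<open>n \<ge> 2\<close>, with
  \<open>q = p^p\<close> (\<open>power_le_U_alpha\<close>). If \<open>E U(\<xi> / r) \<le> 1\<close> and \<open>E \<xi> = 0\<close>, the linear term of
  \<open>F\<^bsub>\<xi>\<^esub>\<close> vanishes and the others are dominated by a geometric series, so
  \<open>F\<^bsub>\<xi>\<^esub>(t) \<le> exp(2 (q r t)\<^sup>2)\<close> as long as \<open>q r t \<le> 1/2\<close>. For a sum \<open>S\<close> the squares \<open>r\<^sub>k\<^sup>2\<close>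
  add up in the exponent; with \<open>V\<^sup>2 = \<Sum> r\<^sub>k\<^sup>2\<close> and \<open>t = 1 / (2 q V)\<close> this gives
  \<open>F\<^bsub>S\<^esub>(t) \<le> exp(1/2) \<le> 2\<close>.

  Conversely, a bound on \<open>F\<^bsub>S\<^esub>(t)\<close> bounds \<open>E exp(|S / R|^\<alpha>)\<close> for \<open>R = 2^(p-1) / t = (2p)^p V\<close>
  (\<open>nn_integral_exp_powr_le\<close>), and \<open>U(x) \<le> exp(|x|^\<alpha>)\<close>. So \<open>E U(S / R) \<le> 8\<close>, and convexity gives
  \<open>\<parallel>S\<parallel>\<^sub>U \<le> 8 (2p)^p V\<close>. The ratio of the two constants in the theorem is at least \<open>4 (2p)^p\<close>, so this
  is stronger than condition H with the stated constant.
\<close>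

section \<open>Luxemburg norms\<close>

lemma C_function_divide_le:
  assumes "C_function U" "1 \<le> L"
  shows "U (x / L) \<le> U x / L"
proof -
  have "U ((1 - 1 / L) *\<^sub>R 0 + (1 / L) *\<^sub>R x) \<le> (1 - 1 / L) * U 0 + (1 / L) * U x"
    using assms by (intro convex_onD[where A = UNIV]) (auto simp: C_function_def)
  then show ?thesis
    using assms by (simp add: C_function_def)
qed

lemma C_function_nonneg:
  assumes "C_function U"
  shows "0 \<le> U x"
proof -
  have "U ((1 - 1 / 2) *\<^sub>R x + (1 / 2) *\<^sub>R (- x)) \<le> (1 - 1 / 2) * U x + (1 / 2) * U (- x)"
    using assms by (intro convex_onD[where A = UNIV]) (auto simp: C_function_def)
  moreover have "U (- x) = U x" "U 0 = 0"
    using assms by (auto simp: C_function_def)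
  ultimately show ?thesis
    by simp
qed

lemma C_function_divide_antimono:
  assumes "C_function U" "0 < r" "r \<le> s"
  shows "U (x / s) \<le> U (x / r)"
proof -
  have "U (x / r / (s / r)) \<le> U (x / r) / (s / r)"
    using assms by (intro C_function_divide_le) auto
  also have "\<dots> \<le> U (x / r)"
    using C_function_nonneg[OF assms(1), of "x / r"] assms
    by (intro divide_le_eq_1[THEN iffD2] order.trans[OF divide_left_mono[of 1 "s / r"]]) auto
  finally show ?thesis
    using assms by simp
qed

lemma C_function_borel_measurable:
  assumes "C_function U"
  shows "U \<in> borel_measurable borel"
  using assms by (intro borel_measurable_continuous_onI) (auto simp: C_function_def)

text \<open>
  Convexity turns any finite bound on the modular \<open>E U(\<xi> / s)\<close> into a bound on the norm, at the
  price of a factor. This is what makes rough estimates of the modular sufficient below.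
\<close>

lemma nn_integral_C_function_le_1:
  assumes U: "C_function U" and [measurable]: "\<xi> \<in> borel_measurable M"
    and "1 \<le> A" and le: "(\<integral>\<^sup>+\<omega>. ennreal (U (\<xi> \<omega> / s)) \<partial>M) \<le> ennreal A"
  shows "(\<integral>\<^sup>+\<omega>. ennreal (U (\<xi> \<omega> / (A * s))) \<partial>M) \<le> 1"
proof -
  note [measurable] = C_function_borel_measurable[OF U]
  have "(\<integral>\<^sup>+\<omega>. ennreal (U (\<xi> \<omega> / (A * s))) \<partial>M)
      \<le> (\<integral>\<^sup>+\<omega>. ennreal (1 / A) * ennreal (U (\<xi> \<omega> / s)) \<partial>M)"
  proof (intro nn_integral_mono)
    fix \<omega>
    have "U (\<xi> \<omega> / (A * s)) \<le> 1 / A * U (\<xi> \<omega> / s)"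
      using C_function_divide_le[OF U \<open>1 \<le> A\<close>, of "\<xi> \<omega> / s"] by (simp add: mult.commute)
    then show "ennreal (U (\<xi> \<omega> / (A * s))) \<le> ennreal (1 / A) * ennreal (U (\<xi> \<omega> / s))"
      using C_function_nonneg[OF U] \<open>1 \<le> A\<close> by (subst ennreal_mult[symmetric]) (auto intro: ennreal_leI)
  qed
  also have "\<dots> = ennreal (1 / A) * (\<integral>\<^sup>+\<omega>. ennreal (U (\<xi> \<omega> / s)) \<partial>M)"
    by (intro nn_integral_cmult) simp
  also have "\<dots> \<le> ennreal (1 / A) * ennreal A"
    by (intro mult_left_mono le) simp
  also have "\<dots> = 1"
    using \<open>1 \<le> A\<close> by (simp add: ennreal_mult[symmetric])
  finally show ?thesis .
qed

lemma luxemburg_norm_le: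
  assumes "C_function U" "\<xi> \<in> borel_measurable M"
    and "0 < s" "1 \<le> A" and "(\<integral>\<^sup>+\<omega>. ennreal (U (\<xi> \<omega> / s)) \<partial>M) \<le> ennreal A"
  shows "luxemburg_norm M U \<xi> \<le> A * s"
  unfolding luxemburg_norm_def using assms nn_integral_C_function_le_1[OF assms(1,2,4,5)]
  by (intro cInf_lower bdd_belowI[of _ 0]) auto

text \<open>
  The infimum in the norm need not be attained, for instance if it is \<open>0\<close>, so the modular is only
  controlled for \<open>s\<close> strictly above the norm.
\<close>

lemma luxemburg_norm_lessD:
  assumes U: "C_function U" and \<xi>: "\<xi> \<in> orlicz_space M U" and less: "luxemburg_norm M U \<xi> < s"
  shows "(\<integral>\<^sup>+\<omega>. ennreal (U (\<xi> \<omega> / s)) \<partial>M) \<le> 1" and "0 < s"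
proof -
  let ?S = "{r. r > 0 \<and> (\<integral>\<^sup>+\<omega>. ennreal (U (\<xi> \<omega> / r)) \<partial>M) \<le> 1}"
  have \<xi>m: "\<xi> \<in> borel_measurable M"
    using \<xi> by (simp add: orlicz_space_def)
  obtain r0 where r0: "r0 > 0" "(\<integral>\<^sup>+\<omega>. ennreal (U (\<xi> \<omega> / r0)) \<partial>M) < \<infinity>"
    using \<xi> by (auto simp: orlicz_space_def)
  then obtain b where b: "0 \<le> b" "(\<integral>\<^sup>+\<omega>. ennreal (U (\<xi> \<omega> / r0)) \<partial>M) = ennreal b"
    by (auto simp: less_top_ennreal)
  have "(\<integral>\<^sup>+\<omega>. ennreal (U (\<xi> \<omega> / r0)) \<partial>M) \<le> ennreal (max 1 b)"
    unfolding b(2) by (intro ennreal_leI) simp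
  then have "max 1 b * r0 \<in> ?S"
    using r0 nn_integral_C_function_le_1[OF U \<xi>m, of "max 1 b" r0] by simp
  then obtain r where r: "r \<in> ?S" "r < s"
    using cInf_lessD[of ?S s] less by (auto simp: luxemburg_norm_def)
  then show "0 < s" by simp
  have "(\<integral>\<^sup>+\<omega>. ennreal (U (\<xi> \<omega> / s)) \<partial>M) \<le> (\<integral>\<^sup>+\<omega>. ennreal (U (\<xi> \<omega> / r)) \<partial>M)"
    using r C_function_divide_antimono[OF U, of r s]
    by (intro nn_integral_mono ennreal_leI) auto
  then show "(\<integral>\<^sup>+\<omega>. ennreal (U (\<xi> \<omega> / s)) \<partial>M) \<le> 1"
    using r by auto
qed

lemma luxemburg_norm_nonneg:
  assumes U: "C_function U" and \<xi>: "\<xi> \<in> orlicz_space M U"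
  shows "0 \<le> luxemburg_norm M U \<xi>"
proof (rule ccontr)
  assume "\<not> 0 \<le> luxemburg_norm M U \<xi>"
  then show False
    using luxemburg_norm_lessD(2)[OF assms, of 0] by simp
qed


section \<open>Moment generating series of Gevrey type\<close>

text \<open>
  The coefficient of \<open>t ^ n\<close> in the series \<open>F\<^bsub>X\<^esub>\<close>. The absolute value is outside the integral, so
  that a centered variable has no linear term.
\<close>

definition normalized_moment :: "'a measure \<Rightarrow> real \<Rightarrow> ('a \<Rightarrow> real) \<Rightarrow> nat \<Rightarrow> real" where
  "normalized_moment M p X n = \<bar>\<integral>\<omega>. X \<omega> ^ n \<partial>M\<bar> / fact n powr p"

text \<open>
  \<open>F\<^bsub>X\<^esub>(t) \<le> A\<close>. Existence of the moments and convergence of the series are part of the predicate,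
  as the integral and the infinite sum would otherwise take default values.
\<close>

definition moment_series_le :: "'a measure \<Rightarrow> real \<Rightarrow> real \<Rightarrow> ('a \<Rightarrow> real) \<Rightarrow> real \<Rightarrow> bool" where
  "moment_series_le M p t X A \<longleftrightarrow>
     (\<forall>n. integrable M (\<lambda>\<omega>. X \<omega> ^ n)) \<and>
     summable (\<lambda>n. normalized_moment M p X n * t ^ n) \<and>
     (\<Sum>n. normalized_moment M p X n * t ^ n) \<le> A"

lemma normalized_moment_nonneg: "0 \<le> normalized_moment M p X n"
  by (simp add: normalized_moment_def)

text \<open>
  The source of submultiplicativity: the claim amounts to \<open>c \<le> c powr p\<close> for the binomial
  coefficient \<open>c \<ge> 1\<close>.
\<close>

lemma binomial_le_fact_powr_quotient:
  fixes p :: real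
  assumes "j \<le> n" "1 \<le> p"
  shows "real (n choose j) / fact n powr p \<le> 1 / (fact j powr p * fact (n - j) powr p)"
proof -
  have "(fact n :: real) = real (n choose j) * (fact j * fact (n - j))"
    using binomial_fact[OF assms(1), where 'a = real] by simp
  then have eq: "(fact n :: real) powr p = real (n choose j) powr p * (fact j powr p * fact (n - j) powr p)"
    by (simp add: powr_mult)
  have "real (n choose j) powr 1 \<le> real (n choose j) powr p"
    using assms by (intro powr_mono) (auto simp: Suc_le_eq)
  then have "real (n choose j) \<le> real (n choose j) powr p"
    by simp
  moreover have "0 < real (n choose j) powr p"
    using assms by simp
  ultimately show ?thesis
    unfolding eq by (simp add: field_simps)
qed

lemma (in prob_space) indep_var_power_moment:
  fixes X Y :: "'a \<Rightarrow> real"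
  assumes ind: "indep_var borel X borel Y"
    and X: "\<And>n. integrable M (\<lambda>\<omega>. X \<omega> ^ n)" and Y: "\<And>n. integrable M (\<lambda>\<omega>. Y \<omega> ^ n)"
  shows "integrable M (\<lambda>\<omega>. X \<omega> ^ i * Y \<omega> ^ j)"
    and "(\<integral>\<omega>. X \<omega> ^ i * Y \<omega> ^ j \<partial>M) = (\<integral>\<omega>. X \<omega> ^ i \<partial>M) * (\<integral>\<omega>. Y \<omega> ^ j \<partial>M)"
proof -
  have "indep_var borel ((\<lambda>x. x ^ i) \<circ> X) borel ((\<lambda>x. x ^ j) \<circ> Y)"
    by (rule indep_var_compose[OF ind]) auto
  then have "indep_var borel (\<lambda>\<omega>. X \<omega> ^ i) borel (\<lambda>\<omega>. Y \<omega> ^ j)"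
    by (simp add: o_def)
  from indep_var_integrable[OF this X Y] indep_var_lebesgue_integral[OF this X Y]
  show "integrable M (\<lambda>\<omega>. X \<omega> ^ i * Y \<omega> ^ j)"
    and "(\<integral>\<omega>. X \<omega> ^ i * Y \<omega> ^ j \<partial>M) = (\<integral>\<omega>. X \<omega> ^ i \<partial>M) * (\<integral>\<omega>. Y \<omega> ^ j \<partial>M)" .
qed

lemma (in prob_space) normalized_moment_add_le:
  fixes X Y :: "'a \<Rightarrow> real"
  assumes ind: "indep_var borel X borel Y" and p: "1 \<le> p"
    and X: "\<And>n. integrable M (\<lambda>\<omega>. X \<omega> ^ n)" and Y: "\<And>n. integrable M (\<lambda>\<omega>. Y \<omega> ^ n)"
  shows "integrable M (\<lambda>\<omega>. (X \<omega> + Y \<omega>) ^ n)"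
    and "normalized_moment M p (\<lambda>\<omega>. X \<omega> + Y \<omega>) n
      \<le> (\<Sum>j\<le>n. normalized_moment M p X j * normalized_moment M p Y (n - j))"
proof -
  note XY = indep_var_power_moment[OF ind X Y]
  have int: "integrable M (\<lambda>\<omega>. real (n choose j) * (X \<omega> ^ j * Y \<omega> ^ (n - j)))" for j
    by (intro integrable_mult_right XY)
  show "integrable M (\<lambda>\<omega>. (X \<omega> + Y \<omega>) ^ n)"
    unfolding binomial_ring mult.assoc by (intro Bochner_Integration.integrable_sum int)
  have "(\<integral>\<omega>. (X \<omega> + Y \<omega>) ^ n \<partial>M)
      = (\<Sum>j\<le>n. real (n choose j) * ((\<integral>\<omega>. X \<omega> ^ j \<partial>M) * (\<integral>\<omega>. Y \<omega> ^ (n - j) \<partial>M)))"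
    unfolding binomial_ring mult.assoc
    by (subst Bochner_Integration.integral_sum) (simp_all only: int integral_mult_right_zero XY)
  then have "normalized_moment M p (\<lambda>\<omega>. X \<omega> + Y \<omega>) n
      \<le> (\<Sum>j\<le>n. \<bar>real (n choose j) * ((\<integral>\<omega>. X \<omega> ^ j \<partial>M) * (\<integral>\<omega>. Y \<omega> ^ (n - j) \<partial>M))\<bar>) / fact n powr p"
    unfolding normalized_moment_def by (auto intro!: divide_right_mono sum_abs)
  also have "\<dots> = (\<Sum>j\<le>n. real (n choose j) / fact n powr p *
      (\<bar>\<integral>\<omega>. X \<omega> ^ j \<partial>M\<bar> * \<bar>\<integral>\<omega>. Y \<omega> ^ (n - j) \<partial>M\<bar>))"
    by (simp add: sum_divide_distrib abs_mult)
  also have "\<dots> \<le> (\<Sum>j\<le>n. 1 / (fact j powr p * fact (n - j) powr p) *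
      (\<bar>\<integral>\<omega>. X \<omega> ^ j \<partial>M\<bar> * \<bar>\<integral>\<omega>. Y \<omega> ^ (n - j) \<partial>M\<bar>))"
    using p by (intro sum_mono mult_right_mono binomial_le_fact_powr_quotient) auto
  finally show "normalized_moment M p (\<lambda>\<omega>. X \<omega> + Y \<omega>) n
      \<le> (\<Sum>j\<le>n. normalized_moment M p X j * normalized_moment M p Y (n - j))"
    by (simp add: normalized_moment_def)
qed

text \<open>
  The bound on the moments of \<open>X + Y\<close> is a convolution, so summing it gives a Cauchy product.
\<close>

lemma (in prob_space) moment_series_le_add:
  fixes X Y :: "'a \<Rightarrow> real"
  assumes ind: "indep_var borel X borel Y" and p: "1 \<le> p" and t: "0 \<le> t"
    and X: "moment_series_le M p t X A" and Y: "moment_series_le M p t Y B"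
  shows "moment_series_le M p t (\<lambda>\<omega>. X \<omega> + Y \<omega>) (A * B)"
proof -
  let ?a = "\<lambda>n. normalized_moment M p X n * t ^ n"
  let ?b = "\<lambda>n. normalized_moment M p Y n * t ^ n"
  let ?c = "\<lambda>n. normalized_moment M p (\<lambda>\<omega>. X \<omega> + Y \<omega>) n * t ^ n"
  have Xi: "\<And>n. integrable M (\<lambda>\<omega>. X \<omega> ^ n)" and Yi: "\<And>n. integrable M (\<lambda>\<omega>. Y \<omega> ^ n)"
    and Xs: "summable ?a" and Ys: "summable ?b" and XA: "suminf ?a \<le> A" and YB: "suminf ?b \<le> B"
    using X Y by (auto simp: moment_series_le_def)
  note add = normalized_moment_add_le[OF ind p Xi Yi]
  have a0: "0 \<le> ?a n" and b0: "0 \<le> ?b n" and c0: "0 \<le> ?c n" for n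
    using t by (simp_all add: normalized_moment_nonneg)
  have prod: "(\<lambda>n. \<Sum>j\<le>n. ?a j * ?b (n - j)) sums (suminf ?a * suminf ?b)"
    using Xs Ys a0 b0 by (intro Cauchy_product_sums) simp_all
  have le: "?c n \<le> (\<Sum>j\<le>n. ?a j * ?b (n - j))" for n
  proof -
    have "?c n \<le> (\<Sum>j\<le>n. normalized_moment M p X j * normalized_moment M p Y (n - j)) * t ^ n"
      using t by (intro mult_right_mono add) auto
    also have "\<dots> = (\<Sum>j\<le>n. ?a j * ?b (n - j))"
      unfolding sum_distrib_right
      by (intro sum.cong refl) (auto simp: power_add[symmetric] algebra_simps)
    finally show ?thesis .
  qed
  have sm: "summable ?c"
    by (rule summable_comparison_test'[OF sums_summable[OF prod]]) (use le c0 in auto)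
  have "suminf ?c \<le> suminf ?a * suminf ?b"
    using suminf_le[OF le sm sums_summable[OF prod]] sums_unique[OF prod] by simp
  also have "\<dots> \<le> A * B"
    using XA YB suminf_nonneg[OF Xs a0] suminf_nonneg[OF Ys b0] by (intro mult_mono) auto
  finally show ?thesis
    unfolding moment_series_le_def using add sm by simp
qed

lemma (in prob_space) moment_series_le_zero: "moment_series_le M p t (\<lambda>_. 0) 1"
proof -
  have "(\<lambda>n. normalized_moment M p (\<lambda>_. 0) n * t ^ n) = (\<lambda>n. if n = 0 then 1 else 0)"
    by (auto simp: normalized_moment_def fun_eq_iff prob_space power_0_left)
  moreover have "(\<lambda>n::nat. if n = 0 then 1 else 0) sums (1::real)"
    using sums_single[of 0 "\<lambda>_. 1::real"] by simp
  ultimately show ?thesis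
    by (simp add: moment_series_le_def sums_iff)
qed

lemma (in prob_space) moment_series_le_sum:
  fixes X :: "'i \<Rightarrow> 'a \<Rightarrow> real"
  assumes "finite I" "indep_vars (\<lambda>_. borel) X I" "1 \<le> p" "0 \<le> t"
    and "\<And>i. i \<in> I \<Longrightarrow> moment_series_le M p t (X i) (A i)"
  shows "moment_series_le M p t (\<lambda>\<omega>. \<Sum>i\<in>I. X i \<omega>) (\<Prod>i\<in>I. A i)"
  using assms
proof (induction I rule: finite_induct)
  case empty
  then show ?case by (simp add: moment_series_le_zero)
next
  case (insert i I)
  have "indep_vars (\<lambda>_. borel) X I"
    using insert.prems(1) by (rule indep_vars_subset) auto
  then have "moment_series_le M p t (\<lambda>\<omega>. \<Sum>i\<in>I. X i \<omega>) (\<Prod>i\<in>I. A i)"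
    using insert by auto
  then have "moment_series_le M p t (\<lambda>\<omega>. X i \<omega> + (\<Sum>i\<in>I. X i \<omega>)) (A i * (\<Prod>i\<in>I. A i))"
    using insert.prems by (intro moment_series_le_add indep_vars_sum insert.hyps) auto
  then show ?case
    using insert.hyps by simp
qed

text \<open>
  With \<open>y = q t\<close>, the series is dominated by \<open>1 + y\<^sup>2 + y\<^sup>3 + \<dots> = 1 / (1 - y) - y\<close>. The missing linear
  term makes the exponent quadratic, which is why the squares of the norms add up.
\<close>

lemma (in prob_space) moment_series_le_centered:
  fixes X :: "'a \<Rightarrow> real"
  assumes int: "\<And>n. integrable M (\<lambda>\<omega>. X \<omega> ^ n)" and mean: "(\<integral>\<omega>. X \<omega> \<partial>M) = 0"
    and le: "\<And>n. 2 \<le> n \<Longrightarrow> normalized_moment M p X n \<le> q ^ n"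
    and "0 \<le> q" "0 \<le> t" and x: "q * t \<le> 1 / 2"
  shows "moment_series_le M p t X (exp (2 * (q * t)\<^sup>2))"
proof -
  define y where "y = q * t"
  have y: "0 \<le> y" "y \<le> 1 / 2" using assms by (auto simp: y_def)
  let ?c = "\<lambda>n. normalized_moment M p X n * t ^ n"
  let ?d = "\<lambda>n. y ^ n - (if n = 1 then y else 0)"
  have d: "?d sums (1 / (1 - y) - y)"
    using y by (intro sums_diff geometric_sums) (auto intro: sums_single)
  have cd: "?c n \<le> ?d n" for n
  proof -
    consider "n = 0" | "n = 1" | "2 \<le> n" by linarith
    then show ?thesis
    proof cases
      case 3
      have "?c n \<le> q ^ n * t ^ n"
        using 3 assms by (intro mult_right_mono le) auto
      then show ?thesis using 3 by (simp add: y_def power_mult_distrib)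
    qed (auto simp: normalized_moment_def prob_space mean)
  qed
  have c0: "0 \<le> ?c n" for n
    using \<open>0 \<le> t\<close> by (simp add: normalized_moment_nonneg)
  have sm: "summable ?c"
    by (rule summable_comparison_test'[OF sums_summable[OF d]]) (use cd c0 in auto)
  have "suminf ?c \<le> 1 / (1 - y) - y"
    using suminf_le[OF cd sm sums_summable[OF d]] sums_unique[OF d] by simp
  also have "\<dots> \<le> 1 + 2 * y\<^sup>2"
  proof -
    have "0 \<le> y\<^sup>2 * (1 - 2 * y)" using y by simp
    then have "1 \<le> (1 + y + 2 * y\<^sup>2) * (1 - y)"
      by (simp add: algebra_simps power2_eq_square)
    then show ?thesis using y by (simp add: field_simps)
  qed
  also have "\<dots> \<le> exp (2 * y\<^sup>2)"
    by (rule exp_ge_add_one_self)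
  finally show ?thesis
    using int sm by (simp add: moment_series_le_def y_def)
qed


section \<open>Moments and the exponential Orlicz function\<close>

lemma power_powr_commute:
  fixes b p :: real
  assumes "0 \<le> b"
  shows "(b ^ n) powr p = (b powr p) ^ n"
  using assms by (induction n) (auto simp: powr_mult)

text \<open>
  The \<open>p\<close>-th power of \<open>z ^ j / j! \<le> exp z\<close> for \<open>z = \<alpha> |x|^\<alpha>\<close>, where \<open>p = 1 / \<alpha>\<close>.
\<close>

lemma power_le_fact_powr_exp:
  fixes \<alpha> x :: real
  assumes \<alpha>: "0 < \<alpha>"
  shows "\<bar>x\<bar> ^ j \<le> ((1 / \<alpha>) powr (1 / \<alpha>)) ^ j * fact j powr (1 / \<alpha>) * exp (\<bar>x\<bar> powr \<alpha>)"
proof -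
  define z where "z = \<alpha> * \<bar>x\<bar> powr \<alpha>"
  have z: "0 \<le> z" using \<alpha> by (simp add: z_def)
  have "z ^ j / fact j \<le> exp z"
    using z sum_le_suminf[OF sums_summable[OF exp_converges[of z]], of "{j}"]
    by (simp add: sums_unique[OF exp_converges[of z]] divide_inverse mult.commute)
  then have "z ^ j \<le> fact j * exp z"
    by (simp add: field_simps)
  then have "(z ^ j) powr (1 / \<alpha>) \<le> (fact j * exp z) powr (1 / \<alpha>)"
    using z \<alpha> by (intro powr_mono2) auto
  then have "(z powr (1 / \<alpha>)) ^ j \<le> fact j powr (1 / \<alpha>) * exp (\<bar>x\<bar> powr \<alpha>)"
    using z \<alpha> by (simp add: power_powr_commute powr_mult exp_powr_real z_def)
  moreover have "z powr (1 / \<alpha>) = \<alpha> powr (1 / \<alpha>) * \<bar>x\<bar>"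
    using \<alpha> by (simp add: z_def powr_mult powr_powr)
  ultimately have "(\<alpha> powr (1 / \<alpha>) * \<bar>x\<bar>) ^ j \<le> fact j powr (1 / \<alpha>) * exp (\<bar>x\<bar> powr \<alpha>)"
    by simp
  then show ?thesis
    using \<alpha> by (simp add: powr_divide power_divide power_mult_distrib field_simps)
qed

lemma x_alpha_pos: "0 < \<alpha> \<Longrightarrow> 0 < x_alpha \<alpha>"
  by (simp add: x_alpha_def)

lemma x_alpha_powr: "0 < \<alpha> \<Longrightarrow> x_alpha \<alpha> powr \<alpha> = 2 / \<alpha>"
  by (simp add: x_alpha_def powr_powr)

text \<open>
  The constant \<open>(e \<alpha> / 2)^(2 / \<alpha>)\<close> is the one that makes \<open>U\<close> continuous: the parabola takes the value
  \<open>exp(2 / \<alpha>)\<close> of \<open>exp(|x|^\<alpha>)\<close> at \<open>x\<^sub>\<alpha>\<close>.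
\<close>

lemma U_alpha_quadratic:
  assumes \<alpha>: "0 < \<alpha>" and x: "\<bar>x\<bar> \<le> x_alpha \<alpha>"
  shows "U_alpha \<alpha> x = exp (2 / \<alpha>) * (\<bar>x\<bar> / x_alpha \<alpha>)\<^sup>2"
proof -
  have "(x_alpha \<alpha>)\<^sup>2 = (2 / \<alpha>) powr (2 / \<alpha>)"
    using \<alpha> by (simp add: x_alpha_def powr_powr flip: powr_numeral)
  moreover have "(exp 1 * \<alpha> / 2) powr (2 / \<alpha>) * (2 / \<alpha>) powr (2 / \<alpha>) = exp (2 / \<alpha>)"
    using \<alpha> by (simp add: exp_powr_real flip: powr_mult)
  ultimately have "(exp 1 * \<alpha> / 2) powr (2 / \<alpha>) * (x_alpha \<alpha>)\<^sup>2 = exp (2 / \<alpha>)"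
    by simp
  then show ?thesis
    using x x_alpha_pos[OF \<alpha>] by (simp add: U_alpha_def field_simps)
qed

text \<open>
  On the quadratic part, with \<open>w = (|x| / x\<^sub>\<alpha>)^\<alpha>\<close>, this is the \<open>(2 / \<alpha>)\<close>-th power of
  \<open>e w \<le> exp w\<close>.
\<close>

lemma U_alpha_le_exp:
  assumes \<alpha>: "0 < \<alpha>"
  shows "U_alpha \<alpha> x \<le> exp (\<bar>x\<bar> powr \<alpha>)"
proof (cases "\<bar>x\<bar> \<le> x_alpha \<alpha>")
  case True
  define w where "w = \<alpha> / 2 * \<bar>x\<bar> powr \<alpha>"
  have w: "0 \<le> w" using \<alpha> by (simp add: w_def)
  have a: "0 < x_alpha \<alpha>" using \<alpha> by (rule x_alpha_pos)
  have "w = (\<bar>x\<bar> / x_alpha \<alpha>) powr \<alpha>"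
    using \<alpha> a by (simp add: w_def powr_divide x_alpha_powr)
  then have "w powr (2 / \<alpha>) = (\<bar>x\<bar> / x_alpha \<alpha>) powr 2"
    using \<alpha> by (simp add: powr_powr)
  then have w2: "w powr (2 / \<alpha>) = (\<bar>x\<bar> / x_alpha \<alpha>)\<^sup>2"
    using a by (simp add: powr_numeral)
  have "w \<le> exp (w - 1)"
    using exp_ge_add_one_self[of "w - 1"] by simp
  then have "exp 1 * w \<le> exp 1 * exp (w - 1)"
    by (intro mult_left_mono) auto
  then have "exp 1 * w \<le> exp w"
    by (simp flip: exp_add)
  then have "(exp 1 * w) powr (2 / \<alpha>) \<le> exp w powr (2 / \<alpha>)"
    using w \<alpha> by (intro powr_mono2) auto
  then show ?thesis
    using w \<alpha> by (simp add: U_alpha_quadratic[OF \<alpha> True] powr_mult exp_powr_real flip: w2) (simp add: w_def)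
qed (simp add: U_alpha_def)

text \<open>
  Up to \<open>x\<^sub>\<alpha>\<close> the function is only quadratic, which is where \<open>j \<ge> 2\<close> is needed: there
  \<open>(|x| / x\<^sub>\<alpha>)^j \<le> (|x| / x\<^sub>\<alpha>)\<^sup>2\<close>, and the claim follows from its case \<open>|x| = x\<^sub>\<alpha>\<close>.
\<close>

lemma power_le_U_alpha:
  fixes x :: real
  assumes \<alpha>: "0 < \<alpha>" and j: "2 \<le> j"
  shows "\<bar>x\<bar> ^ j \<le> ((1 / \<alpha>) powr (1 / \<alpha>)) ^ j * fact j powr (1 / \<alpha>) * U_alpha \<alpha> x"
proof (cases "\<bar>x\<bar> \<le> x_alpha \<alpha>")
  case True
  define D where "D = ((1 / \<alpha>) powr (1 / \<alpha>)) ^ j * fact j powr (1 / \<alpha>)"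
  define a where "a = x_alpha \<alpha>"
  have a: "0 < a" using \<alpha> by (simp add: a_def x_alpha_pos)
  have "(\<bar>x\<bar> / a) ^ j \<le> (\<bar>x\<bar> / a)\<^sup>2"
    using j True a by (intro power_decreasing) (auto simp: a_def)
  moreover have "a ^ j \<le> D * exp (2 / \<alpha>)"
    using power_le_fact_powr_exp[OF \<alpha>, of a j] a \<alpha> by (simp add: D_def a_def x_alpha_powr)
  ultimately have "a ^ j * (\<bar>x\<bar> / a) ^ j \<le> D * exp (2 / \<alpha>) * (\<bar>x\<bar> / a)\<^sup>2"
    using a by (intro mult_mono) (auto simp: D_def)
  then show ?thesis
    using a U_alpha_quadratic[OF \<alpha> True] by (simp add: D_def a_def power_divide mult.assoc)
next
  case False
  then show ?thesis
    using power_le_fact_powr_exp[OF \<alpha>, of x j] by (simp add: U_alpha_def)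
qed

lemma (in prob_space) moment_series_le_U_alpha:
  fixes X :: "'a \<Rightarrow> real"
  assumes \<alpha>: "0 < \<alpha>" "\<alpha> < 1" and X: "centered M X" and r: "0 < r"
    and U: "(\<integral>\<^sup>+\<omega>. ennreal (U_alpha \<alpha> (X \<omega> / r)) \<partial>M) \<le> 1"
    and t: "0 \<le> t" "(1 / \<alpha>) powr (1 / \<alpha>) * r * t \<le> 1 / 2"
  shows "moment_series_le M (1 / \<alpha>) t X (exp (2 * ((1 / \<alpha>) powr (1 / \<alpha>) * r * t)\<^sup>2))"
proof -
  let ?q = "(1 / \<alpha>) powr (1 / \<alpha>)"
  note [measurable] = C_function_borel_measurable[OF C_function_U_alpha[OF \<alpha>]]
  have U0: "0 \<le> U_alpha \<alpha> x" for x
    by (rule C_function_nonneg[OF C_function_U_alpha[OF \<alpha>]])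
  have Xi: "integrable M X" and X0: "(\<integral>\<omega>. X \<omega> \<partial>M) = 0"
    using X by (auto simp: centered_def)
  have [measurable]: "X \<in> borel_measurable M" using Xi by auto
  have Ui: "integrable M (\<lambda>\<omega>. U_alpha \<alpha> (X \<omega> / r))"
    using U U0 by (intro integrableI_nonneg) (auto intro: order.strict_trans1)
  have U1: "(\<integral>\<omega>. U_alpha \<alpha> (X \<omega> / r) \<partial>M) \<le> 1"
    using U nn_integral_eq_integral[OF Ui] U0 by simp
  have bound: "\<bar>X \<omega> ^ n\<bar> \<le> (?q * r) ^ n * fact n powr (1 / \<alpha>) * U_alpha \<alpha> (X \<omega> / r)" if "2 \<le> n" for n \<omega>
    using power_le_U_alpha[OF \<alpha>(1) that, of "X \<omega> / r"] r
    by (simp add: power_abs power_divide power_mult_distrib field_simps)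
  have int: "integrable M (\<lambda>\<omega>. X \<omega> ^ n)" for n
  proof -
    consider "n = 0" | "n = 1" | "2 \<le> n" by linarith
    then show ?thesis
    proof cases
      case 3
      show ?thesis
        by (rule Bochner_Integration.integrable_bound[OF integrable_mult_right[OF Ui, of "(?q * r) ^ n * fact n powr (1 / \<alpha>)"]])
          (use bound[OF 3] in \<open>auto intro: order.trans[OF _ abs_ge_self]\<close>)
    qed (auto simp: Xi)
  qed
  have mom: "normalized_moment M (1 / \<alpha>) X n \<le> (?q * r) ^ n" if n: "2 \<le> n" for n
  proof -
    have "\<bar>\<integral>\<omega>. X \<omega> ^ n \<partial>M\<bar> \<le> (\<integral>\<omega>. \<bar>X \<omega> ^ n\<bar> \<partial>M)"
      by (rule integral_abs_bound)
    also have "\<dots> \<le> (\<integral>\<omega>. (?q * r) ^ n * fact n powr (1 / \<alpha>) * U_alpha \<alpha> (X \<omega> / r) \<partial>M)"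
      using int Ui bound[OF n] by (intro integral_mono) auto
    also have "\<dots> = (?q * r) ^ n * fact n powr (1 / \<alpha>) * (\<integral>\<omega>. U_alpha \<alpha> (X \<omega> / r) \<partial>M)"
      by simp
    also have "\<dots> \<le> (?q * r) ^ n * fact n powr (1 / \<alpha>) * 1"
      using U1 r by (intro mult_left_mono) auto
    finally show ?thesis
      by (simp add: normalized_moment_def field_simps)
  qed
  show ?thesis
    using moment_series_le_centered[OF int X0 mom _ t] r by simp
qed

text \<open>
  Put \<open>p = 1 / \<alpha>\<close>, \<open>R = 2^(p - 1) / t\<close> and \<open>z = |X / R|^\<alpha>\<close>. Passing from \<open>exp z\<close> to \<open>2 cosh z\<close> leaves only even powers, whose
  expectations are the moments of \<open>X\<close> without absolute values. The terms are then to be replaced by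
  their \<open>p\<close>-th powers, which are multiples of \<open>X ^ n / (n!)^p\<close>: write
  \<open>z ^ n / n! = 2^(-n) c\<close> with \<open>c = (2 z)^n / n!\<close>, and use \<open>c \<le> 1 + c powr p\<close>. The factor \<open>2^(-n)\<close> makes the
  constants \<open>1\<close> summable, and the choice of \<open>R\<close> absorbs the powers of \<open>2\<close>.
\<close>

lemma (in prob_space) nn_integral_exp_powr_le:
  fixes X :: "'a \<Rightarrow> real"
  assumes \<alpha>: "0 < \<alpha>" "\<alpha> < 1" and t: "0 < t" and X: "moment_series_le M (1 / \<alpha>) t X A"
  shows "(\<integral>\<^sup>+\<omega>. ennreal (exp (\<bar>X \<omega> / (2 powr (1 / \<alpha> - 1) / t)\<bar> powr \<alpha>)) \<partial>M) \<le> ennreal (4 + 2 * A)"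
proof -
  define p where "p = 1 / \<alpha>"
  define R where "R = 2 powr (p - 1) / t"
  have p: "1 < p" using \<alpha> by (simp add: p_def)
  have R: "0 < R" using t by (simp add: R_def)
  have int: "\<And>n. integrable M (\<lambda>\<omega>. X \<omega> ^ n)"
    and sm: "summable (\<lambda>n. normalized_moment M p X n * t ^ n)"
    and A: "(\<Sum>n. normalized_moment M p X n * t ^ n) \<le> A"
    using X by (auto simp: moment_series_le_def p_def)
  have [measurable]: "X \<in> borel_measurable M"
    using int[of 1] by auto
  define h where "h = (\<lambda>n \<omega>. if even n then 2 * (1 / 2) ^ n + 2 * (t ^ n * X \<omega> ^ n / fact n powr p) else 0)"
  have h0: "0 \<le> h n \<omega>" for n \<omega>
    using t by (auto simp: h_def zero_le_even_power intro!: add_nonneg_nonneg mult_nonneg_nonneg divide_nonneg_nonneg)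
  have pointwise: "ennreal (exp (\<bar>X \<omega> / R\<bar> powr \<alpha>)) \<le> (\<Sum>n. ennreal (h n \<omega>))" for \<omega>
  proof -
    define z where "z = \<bar>X \<omega> / R\<bar> powr \<alpha>"
    have z: "0 \<le> z" by (simp add: z_def)
    let ?c = "\<lambda>n. if even n then z ^ n /\<^sub>R fact n else 0"
    have "exp z \<le> 2 * cosh z"
      by (simp add: cosh_def)
    then have "ennreal (exp z) \<le> ennreal (2 * cosh z)"
      by (rule ennreal_leI)
    also have "\<dots> = (\<Sum>n. ennreal (2 * ?c n))"
      using z by (intro suminf_ennreal_eq[symmetric] sums_mult cosh_converges) auto
    also have "\<dots> \<le> (\<Sum>n. ennreal (h n \<omega>))"
    proof (intro suminf_le summableI ennreal_leI)
      fix n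
      show "2 * ?c n \<le> h n \<omega>"
      proof (cases "even n")
        case True
        define c where "c = (2 * z) ^ n / fact n"
        have c: "0 \<le> c" using z by (simp add: c_def)
        have "c \<le> 1 + c powr p"
        proof (cases "c \<le> 1")
          case False
          then have "c powr 1 \<le> c powr p" using p by (intro powr_mono) auto
          then show ?thesis using c by simp
        qed (use powr_ge_zero[of c p] in linarith)
        moreover have "c powr p = 2 ^ n * (t ^ n * X \<omega> ^ n / fact n powr p)"
        proof -
          have "(2 * z) powr p = 2 powr p * \<bar>X \<omega>\<bar> / R"
            using \<alpha> R by (simp add: z_def powr_mult powr_powr p_def)
          also have "\<dots> = 2 * t * \<bar>X \<omega>\<bar>"
            using t by (simp add: R_def powr_diff)
          finally have "((2 * z) powr p) ^ n = 2 ^ n * t ^ n * X \<omega> ^ n"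
            using True by (simp add: power_mult_distrib power_even_abs)
          moreover have "((2 * z) ^ n) powr p = ((2 * z) powr p) ^ n"
            using z by (intro power_powr_commute) simp
          ultimately show ?thesis
            unfolding c_def powr_divide by (simp only: mult.assoc times_divide_eq_right)
        qed
        ultimately have "2 * (1 / 2) ^ n * c \<le> 2 * (1 / 2) ^ n * (1 + 2 ^ n * (t ^ n * X \<omega> ^ n / fact n powr p))"
          by (intro mult_left_mono) auto
        also have "\<dots> = h n \<omega>"
          using True by (simp add: h_def algebra_simps power_one_over)
        finally have "2 * (1 / 2) ^ n * c \<le> h n \<omega>" .
        moreover have half: "(1 / 2) ^ n * (2 * z) ^ n = z ^ n"
          unfolding power_mult_distrib[symmetric] by simp
        have "2 * (1 / 2) ^ n * c = 2 * (z ^ n / fact n)"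
          unfolding c_def half[symmetric] by (simp only: mult.assoc times_divide_eq_right)
        then have "2 * ?c n = 2 * (1 / 2) ^ n * c"
          using True by (simp only: if_True real_scaleR_def divide_inverse mult.commute)
        ultimately show ?thesis by (simp only:)
      qed (simp add: h_def)
    qed
    finally show ?thesis by (simp add: z_def)
  qed
  have hint: "integrable M (h n)" for n
    using int[of n] by (cases "even n") (simp_all add: h_def)
  have hI: "(\<integral>\<omega>. h n \<omega> \<partial>M) \<le> 2 * (1 / 2) ^ n + 2 * (normalized_moment M p X n * t ^ n)" for n
  proof (cases "even n")
    case True
    have "(\<integral>\<omega>. h n \<omega> \<partial>M) = 2 * (1 / 2) ^ n + 2 * (t ^ n * (\<integral>\<omega>. X \<omega> ^ n \<partial>M) / fact n powr p)"
      unfolding h_def using True int[of n] by (simp add: prob_space)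
    also have "\<dots> \<le> 2 * (1 / 2) ^ n + 2 * (normalized_moment M p X n * t ^ n)"
      using t by (auto simp: normalized_moment_def mult.commute intro!: divide_right_mono mult_left_mono)
    finally show ?thesis .
  qed (use t in \<open>simp add: h_def normalized_moment_nonneg\<close>)
  have sums: "(\<lambda>n. 2 * (1 / 2) ^ n + 2 * (normalized_moment M p X n * t ^ n))
      sums (2 * (1 / (1 - 1 / 2)) + 2 * (\<Sum>n. normalized_moment M p X n * t ^ n))"
    using sm by (intro sums_add sums_mult geometric_sums summable_sums) auto
  have "(\<integral>\<^sup>+\<omega>. ennreal (exp (\<bar>X \<omega> / R\<bar> powr \<alpha>)) \<partial>M) \<le> (\<integral>\<^sup>+\<omega>. (\<Sum>n. ennreal (h n \<omega>)) \<partial>M)"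
    by (intro nn_integral_mono pointwise)
  also have "\<dots> = (\<Sum>n. \<integral>\<^sup>+\<omega>. ennreal (h n \<omega>) \<partial>M)"
    by (intro nn_integral_suminf) (auto simp: h_def)
  also have "\<dots> \<le> (\<Sum>n. ennreal (2 * (1 / 2) ^ n + 2 * (normalized_moment M p X n * t ^ n)))"
    using hI by (intro suminf_le summableI)
      (auto simp: nn_integral_eq_integral[OF hint] h0 intro: ennreal_leI)
  also have "\<dots> = ennreal (2 * (1 / (1 - 1 / 2)) + 2 * (\<Sum>n. normalized_moment M p X n * t ^ n))"
    using t by (intro suminf_ennreal_eq sums) (simp add: normalized_moment_nonneg)
  also have "\<dots> \<le> ennreal (4 + 2 * A)"
    using A by (intro ennreal_leI) simp
  finally show ?thesis by (simp add: R_def p_def)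
qed


section \<open>Condition H\<close>

lemma (in prob_space) luxemburg_norm_sum_le:
  fixes X :: "'i \<Rightarrow> 'a \<Rightarrow> real"
  assumes \<alpha>: "0 < \<alpha>" "\<alpha> < 1" and I: "finite I" and ind: "indep_vars (\<lambda>_. borel) X I"
    and X: "\<And>i. i \<in> I \<Longrightarrow> centered M (X i)" and r: "\<And>i. i \<in> I \<Longrightarrow> 0 < r i"
    and U: "\<And>i. i \<in> I \<Longrightarrow> (\<integral>\<^sup>+\<omega>. ennreal (U_alpha \<alpha> (X i \<omega> / r i)) \<partial>M) \<le> 1"
    and V: "0 < V" "(\<Sum>i\<in>I. (r i)\<^sup>2) \<le> V\<^sup>2"
  shows "(\<lambda>\<omega>. \<Sum>i\<in>I. X i \<omega>) \<in> orlicz_space M (U_alpha \<alpha>)"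
    and "luxemburg_norm M (U_alpha \<alpha>) (\<lambda>\<omega>. \<Sum>i\<in>I. X i \<omega>) \<le> 8 * ((2 / \<alpha>) powr (1 / \<alpha>) * V)"
proof -
  define p where "p = 1 / \<alpha>"
  define q where "q = p powr p"
  define t where "t = 1 / (2 * q * V)"
  define S where "S = (\<lambda>\<omega>. \<Sum>i\<in>I. X i \<omega>)"
  have p: "1 < p" using \<alpha> by (simp add: p_def)
  have q: "0 < q" using p by (simp add: q_def)
  have t: "0 < t" using q V by (simp add: t_def)
  note UC = C_function_U_alpha[OF \<alpha>]
  have rV: "r i \<le> V" if "i \<in> I" for i
  proof -
    have "(r i)\<^sup>2 \<le> (\<Sum>i\<in>I. (r i)\<^sup>2)"
      using I that by (intro member_le_sum) auto
    then have "(r i)\<^sup>2 \<le> V\<^sup>2"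
      using V(2) by linarith
    then show ?thesis
      using V(1) by (intro power2_le_imp_le[of "r i" V]) auto
  qed
  have "moment_series_le M p t (X i) (exp (2 * (q * r i * t)\<^sup>2))" if i: "i \<in> I" for i
  proof -
    have "q * r i * t \<le> q * V * t"
      using q t rV[OF i] by (intro mult_right_mono mult_left_mono) auto
    also have "\<dots> = 1 / 2"
      using q V by (simp add: t_def)
    finally show ?thesis
      using moment_series_le_U_alpha[OF \<alpha> X[OF i] r[OF i] U[OF i], of t] t
      by (simp add: p_def q_def)
  qed
  then have "moment_series_le M p t S (\<Prod>i\<in>I. exp (2 * (q * r i * t)\<^sup>2))"
    unfolding S_def using I ind p t by (intro moment_series_le_sum) auto
  moreover have "(\<Prod>i\<in>I. exp (2 * (q * r i * t)\<^sup>2)) \<le> 2"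
  proof -
    have "(\<Prod>i\<in>I. exp (2 * (q * r i * t)\<^sup>2)) = exp (2 * (q * t)\<^sup>2 * (\<Sum>i\<in>I. (r i)\<^sup>2))"
      using I by (simp add: exp_sum[symmetric] sum_distrib_left power_mult_distrib algebra_simps)
    also have "\<dots> \<le> exp (2 * (q * t)\<^sup>2 * V\<^sup>2)"
      using V by (simp add: mult_left_mono)
    also have "2 * (q * t)\<^sup>2 * V\<^sup>2 = 1 / 2"
      using q V by (simp add: t_def power2_eq_square)
    also have "exp (1 / 2 :: real) \<le> 2"
    proof (rule power2_le_imp_le)
      have "(exp (1 / 2 :: real))\<^sup>2 = exp 1"
        by (simp flip: exp_double)
      then show "(exp (1 / 2 :: real))\<^sup>2 \<le> 2\<^sup>2"
        using exp_le by simp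
    qed simp
    finally show ?thesis .
  qed
  ultimately have S: "moment_series_le M p t S 2"
    by (auto simp: moment_series_le_def)
  define R where "R = 2 powr (p - 1) / t"
  have R: "0 < R" using t by (simp add: R_def)
  have "(\<integral>\<^sup>+\<omega>. ennreal (U_alpha \<alpha> (S \<omega> / R)) \<partial>M) \<le> (\<integral>\<^sup>+\<omega>. ennreal (exp (\<bar>S \<omega> / R\<bar> powr \<alpha>)) \<partial>M)"
    by (intro nn_integral_mono ennreal_leI U_alpha_le_exp \<alpha>)
  also have "\<dots> \<le> ennreal 8"
    using nn_integral_exp_powr_le[OF \<alpha> t, of S 2] S by (simp add: R_def p_def)
  finally have US: "(\<integral>\<^sup>+\<omega>. ennreal (U_alpha \<alpha> (S \<omega> / R)) \<partial>M) \<le> ennreal 8" .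
  have "integrable M (\<lambda>\<omega>. S \<omega> ^ 1)"
    using S unfolding moment_series_le_def by blast
  then have Sm: "S \<in> borel_measurable M"
    by auto
  have "S \<in> orlicz_space M (U_alpha \<alpha>)"
    using R Sm order.strict_trans1[OF US ennreal_less_top] by (auto simp: orlicz_space_def)
  then show "(\<lambda>\<omega>. \<Sum>i\<in>I. X i \<omega>) \<in> orlicz_space M (U_alpha \<alpha>)"
    by (simp add: S_def)
  have "luxemburg_norm M (U_alpha \<alpha>) S \<le> 8 * R"
    using R US by (intro luxemburg_norm_le[OF UC Sm]) auto
  also have "R = (2 / \<alpha>) powr (1 / \<alpha>) * V"
  proof -
    have "R = 2 powr p * p powr p * V"
      using q V by (simp add: R_def t_def powr_diff q_def)
    also have "2 powr p * p powr p = (2 / \<alpha>) powr (1 / \<alpha>)"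
      using p by (simp add: p_def flip: powr_mult)
    finally show ?thesis .
  qed
  finally show "luxemburg_norm M (U_alpha \<alpha>) (\<lambda>\<omega>. \<Sum>i\<in>I. X i \<omega>) \<le> 8 * ((2 / \<alpha>) powr (1 / \<alpha>) * V)"
    by (simp add: S_def)
qed

text \<open>
  In the quotient the factors \<open>exp(1 / \<alpha>)\<close> cancel, \<open>(2 / \<alpha>)^(1 / \<alpha>)\<close> splits off, and what remains is at
  least \<open>exp 2 \<ge> 4\<close>.
\<close>

lemma C_psi_U_div_C_U_psi_ge:
  assumes \<alpha>: "0 < \<alpha>"
  shows "4 * (2 / \<alpha>) powr (1 / \<alpha>) \<le> C_psi_U \<alpha> / C_U_psi \<alpha>"
proof -
  have "C_psi_U \<alpha> / C_U_psi \<alpha> = exp (2 / \<alpha> + 2) * (1 + exp (1 / 12) / sqrt (2 * pi)) powr (1 / \<alpha>)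
      * (exp (2 / \<alpha>) + 1) powr (1 / \<alpha>) * (2 / \<alpha>) powr (1 / \<alpha>)"
    using \<alpha> by (simp add: C_psi_U_def C_U_psi_def powr_divide powr_minus field_simps)
  moreover have "4 * 1 * 1 \<le> exp (2 / \<alpha> + 2) * (1 + exp (1 / 12) / sqrt (2 * pi)) powr (1 / \<alpha>)
      * (exp (2 / \<alpha>) + 1) powr (1 / \<alpha>)"
  proof (intro mult_mono ge_one_powr_ge_zero)
    have "4 \<le> (exp 1 :: real) * exp 1"
      using mult_mono[of 2 "exp 1 :: real" 2 "exp 1"] exp_ge_add_one_self[of "1 :: real"] by simp
    also have "\<dots> \<le> exp (2 / \<alpha> + 2)"
      using \<alpha> by (simp flip: exp_add)
    finally show "4 \<le> exp (2 / \<alpha> + 2)" .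
  qed (use \<alpha> in auto)
  ultimately show ?thesis
    using mult_right_mono[of 4 _ "(2 / \<alpha>) powr (1 / \<alpha>)"] by simp
qed

theorem theorem5p2:
  fixes M :: "'a measure" and \<alpha> :: real
  assumes "prob_space M"
    and "0 < \<alpha>" and "\<alpha> < 1"
  shows "condition_H M (orlicz_space M (U_alpha \<alpha>)) (luxemburg_norm M (U_alpha \<alpha>))
           (4 * 9 powr (1 / \<alpha>) * (C_psi_U \<alpha> / C_U_psi \<alpha>)\<^sup>2)"
  unfolding condition_H_def
proof (intro allI impI)
  fix n :: nat and \<xi> :: "nat \<Rightarrow> 'a \<Rightarrow> real"
  assume \<xi>: "\<forall>k\<in>{1..n}. \<xi> k \<in> orlicz_space M (U_alpha \<alpha>) \<and> centered M (\<xi> k)"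
    and ind: "prob_space.indep_vars M (\<lambda>_. borel) \<xi> {1..n}"
  interpret prob_space M by fact
  let ?N = "luxemburg_norm M (U_alpha \<alpha>)"
  define S where "S = (\<lambda>\<omega>. \<Sum>k=1..n. \<xi> k \<omega>)"
  define Q where "Q = (2 / \<alpha>) powr (1 / \<alpha>)"
  note UC = C_function_U_alpha[OF assms(2,3)]
  have N0: "0 \<le> ?N (\<xi> k)" if "k \<in> {1..n}" for k
    using \<xi> that by (intro luxemburg_norm_nonneg UC) auto
  \<comment> \<open>The two \<open>\<epsilon>\<close> keep the scales above the norms and \<open>V\<close> positive, also if norms vanish or \<open>n = 0\<close>.\<close>
  have S: "S \<in> orlicz_space M (U_alpha \<alpha>)"
    and le: "?N S \<le> 8 * (Q * sqrt (\<epsilon> + (\<Sum>k=1..n. (?N (\<xi> k) + \<epsilon>)\<^sup>2)))" if \<epsilon>: "0 < \<epsilon>" for \<epsilon>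
  proof -
    let ?V = "sqrt (\<epsilon> + (\<Sum>k=1..n. (?N (\<xi> k) + \<epsilon>)\<^sup>2))"
    have "0 \<le> (\<Sum>k=1..n. (?N (\<xi> k) + \<epsilon>)\<^sup>2)"
      by (intro sum_nonneg) auto
    then have V: "0 < ?V" "(\<Sum>k=1..n. (?N (\<xi> k) + \<epsilon>)\<^sup>2) \<le> ?V\<^sup>2"
      using \<epsilon> by auto
    have U: "(\<integral>\<^sup>+\<omega>. ennreal (U_alpha \<alpha> (\<xi> k \<omega> / (?N (\<xi> k) + \<epsilon>))) \<partial>M) \<le> 1" if "k \<in> {1..n}" for k
      using \<xi> that \<epsilon> by (intro luxemburg_norm_lessD(1)[OF UC]) auto
    have pos: "0 < ?N (\<xi> k) + \<epsilon>" if "k \<in> {1..n}" for k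
      using N0[OF that] \<epsilon> by simp
    have cent: "centered M (\<xi> k)" if "k \<in> {1..n}" for k
      using \<xi> that by blast
    note * = luxemburg_norm_sum_le[OF assms(2,3) finite_atLeastAtMost ind cent pos U V]
    show "S \<in> orlicz_space M (U_alpha \<alpha>)" "?N S \<le> 8 * (Q * ?V)"
      using * by (auto simp: S_def Q_def)
  qed
  have "((\<lambda>\<epsilon>. 8 * (Q * sqrt (\<epsilon> + (\<Sum>k=1..n. (?N (\<xi> k) + \<epsilon>)\<^sup>2))))
      \<longlongrightarrow> 8 * (Q * sqrt (0 + (\<Sum>k=1..n. (?N (\<xi> k) + 0)\<^sup>2)))) (at_right 0)"
    by (intro tendsto_intros)
  then have "?N S \<le> 8 * (Q * sqrt (0 + (\<Sum>k=1..n. (?N (\<xi> k) + 0)\<^sup>2)))"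
    by (rule tendsto_lowerbound) (use le in \<open>auto intro: eventually_mono[OF eventually_at_right_less]\<close>)
  then have "?N S \<le> 2 * (4 * Q) * sqrt (\<Sum>k=1..n. (?N (\<xi> k))\<^sup>2)"
    by simp
  also have "\<dots> \<le> 2 * (C_psi_U \<alpha> / C_U_psi \<alpha>) * sqrt (\<Sum>k=1..n. (?N (\<xi> k))\<^sup>2)"
    unfolding Q_def using C_psi_U_div_C_U_psi_ge[OF assms(2)]
    by (intro mult_right_mono mult_left_mono) (auto intro: sum_nonneg)
  finally have "(?N S)\<^sup>2 \<le> (2 * (C_psi_U \<alpha> / C_U_psi \<alpha>) * sqrt (\<Sum>k=1..n. (?N (\<xi> k))\<^sup>2))\<^sup>2"
    using luxemburg_norm_nonneg[OF UC S[of 1]] by (intro power_mono) auto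
  also have "\<dots> = 4 * 1 * (C_psi_U \<alpha> / C_U_psi \<alpha>)\<^sup>2 * (\<Sum>k=1..n. (?N (\<xi> k))\<^sup>2)"
    by (simp add: power_mult_distrib power_divide sum_nonneg)
  also have "\<dots> \<le> 4 * 9 powr (1 / \<alpha>) * (C_psi_U \<alpha> / C_U_psi \<alpha>)\<^sup>2 * (\<Sum>k=1..n. (?N (\<xi> k))\<^sup>2)"
    using assms(2) by (intro mult_right_mono mult_left_mono ge_one_powr_ge_zero) (auto intro: sum_nonneg)
  finally show "(?N (\<lambda>\<omega>. \<Sum>k=1..n. \<xi> k \<omega>))\<^sup>2
      \<le> 4 * 9 powr (1 / \<alpha>) * (C_psi_U \<alpha> / C_U_psi \<alpha>)\<^sup>2 * (\<Sum>k=1..n. (?N (\<xi> k))\<^sup>2)"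
    by (simp add: S_def)
qed

end
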